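(* For every integer $k\ge 1$, $\mathfrak{b}(\mathbf{R}_\forall^k)=\mathfrak{b}$ and $\mathfrak{d}(\mathbf{R}_\forall^k)=\mathfrak{d}$, whereas $\mathfrak{b}(\mathbf{R}_\exists^k)=\mathfrak{d}$ and $\mathfrak{d}(\mathbf{R}_\exists^k)=\mathfrak{b}$.
   Context: A relational system $\mathbf{R}=\langle X,Y,\sqsubset\rangle$ consists of two non-empty sets $X,Y$ and a relation $\sqsubset$ between elements of $X$ and elements of $Y$. A set $F\subseteq X$ is $\mathbf{R}$-bounded if $\exists y\in Y\,\forall x\in F\; x\sqsubset y$, and $\mathbf{R}$-unbounded otherwise; $E\subseteq Y$ is $\mathbf{R}$-dominating if $\forall x\in X\,\exists y\in E\; x\sqsubset y$. Put $\mathfrak{b}(\mathbf{R})=\min\{|F|: F\subseteq X \text{ is } \mathbf{R}\text{-unbounded}\}$ and $\mathfrak{d}(\mathbf{R})=\min\{|D|: D\subseteq Y\text{ is }\mathbf{R}\text{-dominating}\}$. $\omega^{\uparrow\omega}$ is the set of strictly increasing functions $\omega\to\omega$; $[\omega]^\omega$ is the set of infinite subsets of $\omega$; $[a,b)=\{m\in\omega: a\le m<b\}$; $\forall^\infty n$ means "for all but finitely many $n\in\omega$", $\exists^\infty n$ means "for infinitely many $n\in\omega$". $\mathfrak{b}$ and $\mathfrak{d}$ denote $\mathfrak{b}(\mathbf{D})$ and $\mathfrak{d}(\mathbf{D})$ for $\mathbf{D}=\langle\omega^{\uparrow\omega},\omega^{\uparrow\omega},\le^*\rangle$, where $x\le^*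 y$ means $\forall^\infty n\; x(n)\le y(n)$. For $\iota\in\{\forall,\exists\}$, $\mathbf{R}_\iota^k=\langle\omega^{\uparrow\omega},[\omega]^\omega,\sqsubset_\iota^k\rangle$, where $f\sqsubset_\iota^k X$ iff $\iota^\infty n\; |[f(n),f(n+1))\cap X|\le k$. *)

theory Defs
  imports Main
begin

unbundle cardinal_syntax

record ('x, 'y) rel_system =
  challenges :: "'x set"
  responses :: "'y set"
  related :: "'x \<Rightarrow> 'y \<Rightarrow> bool"

definition relational_system :: "('x, 'y) rel_system \<Rightarrow> bool" where
  "relational_system R \<longleftrightarrow> challenges R \<noteq> {} \<and> responses R \<noteq> {}"

definition bounded_in :: "('x, 'y) rel_system \<Rightarrow> 'x set \<Rightarrow> bool" where
  "bounded_in R F \<longleftrightarrow> F \<subseteq> challenges R \<and> (\<exists>y\<in>responses R. \<forall>x\<in>F. related R x y)"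

definition unbounded_in :: "('x, 'y) rel_system \<Rightarrow> 'x set \<Rightarrow> bool" where
  "unbounded_in R F \<longleftrightarrow> F \<subseteq> challenges R \<and> \<not> bounded_in R F"

definition dominating_in :: "('x, 'y) rel_system \<Rightarrow> 'y set \<Rightarrow> bool" where
  "dominating_in R E \<longleftrightarrow> E \<subseteq> responses R \<and> (\<forall>x\<in>challenges R. \<exists>y\<in>E. related R x y)"

(* Cardinals are cardinal orders of the BNF library, to be compared with =o and \<le>o, also
   across different base types. The minimum is determined up to =o. It is an unspecified
   value if K is empty. *)
definition min_card :: "'a rel set \<Rightarrow> 'a rel" where
  "min_card K = (SOME r. r \<in> K \<and> (\<forall>r'\<in>K. r \<le>o r'))"

lemma min_card_least:
  assumes "K \<noteq> {}" and "\<forall>r\<in>K. Card_order r"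
  shows "min_card K \<in> K \<and> (\<forall>r'\<in>K. min_card K \<le>o r')"
  unfolding min_card_def
  by (rule someI_ex) (use exists_minim_Card_order[OF assms] in blast)

definition bnum :: "('x, 'y) rel_system \<Rightarrow> 'x rel" where
  "bnum R = min_card {|F| | F. unbounded_in R F}"

definition dnum :: "('x, 'y) rel_system \<Rightarrow> 'y rel" where
  "dnum R = min_card {|E| | E. dominating_in R E}"

lemma bnum_least:
  assumes "unbounded_in R F"
  shows "\<exists>F'. unbounded_in R F' \<and> bnum R = |F'|" and "bnum R \<le>o |F|"
proof -
  let ?K = "{|F| | F. unbounded_in R F}"
  have "?K \<noteq> {}" using assms by blast
  moreover have "\<forall>r\<in>?K. Card_order r" using card_of_Card_order by blast
  ultimately have "min_card ?K \<in> ?K \<and> (\<forall>r'\<in>?K. min_card ?K \<le>o r')"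
    by (rule min_card_least)
  with assms show "\<exists>F'. unbounded_in R F' \<and> bnum R = |F'|" and "bnum R \<le>o |F|"
    unfolding bnum_def by blast+
qed

lemma dnum_least:
  assumes "dominating_in R E"
  shows "\<exists>E'. dominating_in R E' \<and> dnum R = |E'|" and "dnum R \<le>o |E|"
proof -
  let ?K = "{|E| | E. dominating_in R E}"
  have "?K \<noteq> {}" using assms by blast
  moreover have "\<forall>r\<in>?K. Card_order r" using card_of_Card_order by blast
  ultimately have "min_card ?K \<in> ?K \<and> (\<forall>r'\<in>?K. min_card ?K \<le>o r')"
    by (rule min_card_least)
  with assms show "\<exists>E'. dominating_in R E' \<and> dnum R = |E'|" and "dnum R \<le>o |E|"
    unfolding dnum_def by blast+
qed

definition increasing_funs :: "(nat \<Rightarrow> nat) set" where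
  "increasing_funs = {f. strict_mono f}"

definition infinite_sets :: "nat set set" where
  "infinite_sets = {A. infinite A}"

definition D_sys :: "(nat \<Rightarrow> nat, nat \<Rightarrow> nat) rel_system" where
  "D_sys = \<lparr>challenges = increasing_funs, responses = increasing_funs,
    related = (\<lambda>x y. \<forall>\<^sub>\<infinity>n. x n \<le> y n)\<rparr>"

definition R_all :: "nat \<Rightarrow> (nat \<Rightarrow> nat, nat set) rel_system" where
  "R_all k = \<lparr>challenges = increasing_funs, responses = infinite_sets,
    related = (\<lambda>f X. \<forall>\<^sub>\<infinity>n. card ({f n..<f (Suc n)} \<inter> X) \<le> k)\<rparr>"

definition R_ex :: "nat \<Rightarrow> (nat \<Rightarrow> nat, nat set) rel_system" where
  "R_ex k = \<lparr>challenges = increasing_funs, responses = infinite_sets,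
    related = (\<lambda>f X. \<exists>\<^sub>\<infinity>n. card ({f n..<f (Suc n)} \<inter> X) \<le> k)\<rparr>"

lemma relational_system_instances:
  "relational_system D_sys" "relational_system (R_all k)" "relational_system (R_ex k)"
proof -
  have "id \<in> increasing_funs" "UNIV \<in> infinite_sets"
    by (auto simp: increasing_funs_def infinite_sets_def strict_mono_def)
  then show "relational_system D_sys" "relational_system (R_all k)" "relational_system (R_ex k)"
    by (auto simp: relational_system_def D_sys_def R_all_def R_ex_def)
qed

end

theory Submission
  imports Defs "HOL-Library.Infinite_Set"
begin

text \<open>
  The proof exhibits \<^emph>\<open>Tukey connections\<close>: a pair of maps, one between the challenges and one
  backwards between the responses, that turns a correct response in one system into a correct
  response in the other. Such a pair sends unbounded sets to unbounded sets and dominating sets to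
  dominating sets, so it compares both cardinals at once. Connections in both directions are given
  between \<open>R_all k\<close> and \<open>D_sys\<close>, and between \<open>R_ex k\<close> and the dual of \<open>D_sys\<close>, in which
  challenges and responses are exchanged and the relation is negated; passing to the dual
  exchanges \<open>bnum\<close> and \<open>dnum\<close>.

  A single construction serves all four connections: the orbit of \<open>0\<close> under \<open>m \<mapsto> g m + 1\<close>. It
  codes a growth rate \<open>g\<close> both as a sparse infinite set and as an interval partition with long
  intervals.

  As a set, the orbit has the property that two of its points \<open>x < x'\<close> satisfy \<open>g x < x'\<close>. If both
  lie in the interval \<open>[f n, f (n + 1))\<close>, then \<open>g\<close> is small compared to \<open>f\<close>: on the one hand
  \<open>g n < f (n + 1)\<close> because \<open>n \<le> f n \<le> x\<close>, on the other hand \<open>g x < f (x + 1)\<close>. The first inequality,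
  for almost all \<open>n\<close>, shows that \<open>g\<close> is dominated by \<open>n \<mapsto> f (n + 1)\<close> when almost all intervals
  contain two points of the orbit. The second shows that only finitely many do so when
  \<open>n \<mapsto> f (n + 1)\<close> is dominated by \<open>g\<close>. Here \<open>k \<ge> 1\<close> enters: more than \<open>k\<close> points are at least two.

  As a partition, the orbit has intervals \<open>[a, b)\<close> with \<open>g a < b\<close>. An infinite set \<open>X\<close> is turned
  into the function that sends \<open>m\<close> to the element of \<open>X\<close> with index \<open>m + c\<close>, before which there are
  at least \<open>c\<close> elements of \<open>X\<close> that are \<open>\<ge> m\<close>. If its value at \<open>a\<close> is at most \<open>g a\<close>, then
  \<open>[a, b)\<close> contains more than \<open>c\<close> elements of \<open>X\<close>; conversely, if almost all intervals contain
  few elements of \<open>X\<close>, then the function grows at least as fast as \<open>g\<close>.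
\<close>

section \<open>Tukey connections and duality\<close>

definition tukey_le :: "('x, 'y) rel_system \<Rightarrow> ('u, 'v) rel_system \<Rightarrow> bool" where
  "tukey_le R S \<longleftrightarrow> (\<exists>\<phi> \<psi>. \<phi> ` challenges R \<subseteq> challenges S \<and> \<psi> ` responses S \<subseteq> responses R \<and>
     (\<forall>x\<in>challenges R. \<forall>y\<in>responses S. related S (\<phi> x) y \<longrightarrow> related R x (\<psi> y)))"

lemma tukey_leI:
  assumes "\<And>x. x \<in> challenges R \<Longrightarrow> \<phi> x \<in> challenges S"
    and "\<And>y. y \<in> responses S \<Longrightarrow> \<psi> y \<in> responses R"
    and "\<And>x y. x \<in> challenges R \<Longrightarrow> y \<in> responses S \<Longrightarrow> related S (\<phi> x) y \<Longrightarrow> related R x (\<psi> y)"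
  shows "tukey_le R S"
  unfolding tukey_le_def using assms by (intro exI[of _ \<phi>] exI[of _ \<psi>]) auto

lemma tukey_leE:
  assumes "tukey_le R S"
  obtains \<phi> \<psi> where "\<And>x. x \<in> challenges R \<Longrightarrow> \<phi> x \<in> challenges S"
    and "\<And>y. y \<in> responses S \<Longrightarrow> \<psi> y \<in> responses R"
    and "\<And>x y. x \<in> challenges R \<Longrightarrow> y \<in> responses S \<Longrightarrow> related S (\<phi> x) y \<Longrightarrow> related R x (\<psi> y)"
  using assms unfolding tukey_le_def image_subset_iff by metis

lemma tukey_le_unbounded:
  assumes "tukey_le R S" "unbounded_in R F"
  shows "\<exists>G. unbounded_in S G \<and> |G| \<le>o |F|"
proof -
  from assms(1) obtain \<phi> \<psi> where \<phi>: "\<And>x. x \<in> challenges R \<Longrightarrow> \<phi> x \<in> challenges S"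
    and \<psi>: "\<And>y. y \<in> responses S \<Longrightarrow> \<psi> y \<in> responses R"
    and rel: "\<And>x y. x \<in> challenges R \<Longrightarrow> y \<in> responses S \<Longrightarrow> related S (\<phi> x) y \<Longrightarrow> related R x (\<psi> y)"
    by (erule tukey_leE)
  have F: "F \<subseteq> challenges R" and unb: "\<not> bounded_in R F"
    using assms(2) by (auto simp: unbounded_in_def)
  have "\<not> bounded_in S (\<phi> ` F)"
  proof
    assume "bounded_in S (\<phi> ` F)"
    then obtain y where y: "y \<in> responses S" "\<forall>x\<in>F. related S (\<phi> x) y"
      by (auto simp: bounded_in_def)
    then have "\<forall>x\<in>F. related R x (\<psi> y)" using rel F by (meson subsetD)
    then show False using unb F \<psi>[OF y(1)] by (auto simp: bounded_in_def)
  qed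
  moreover have "\<phi> ` F \<subseteq> challenges S" using \<phi> F by (meson image_subsetI subsetD)
  ultimately have "unbounded_in S (\<phi> ` F)" by (simp add: unbounded_in_def)
  then show ?thesis using card_of_image by meson
qed

lemma tukey_le_dominating:
  assumes "tukey_le R S" "dominating_in S E"
  shows "\<exists>D. dominating_in R D \<and> |D| \<le>o |E|"
proof -
  from assms(1) obtain \<phi> \<psi> where \<phi>: "\<And>x. x \<in> challenges R \<Longrightarrow> \<phi> x \<in> challenges S"
    and \<psi>: "\<And>y. y \<in> responses S \<Longrightarrow> \<psi> y \<in> responses R"
    and rel: "\<And>x y. x \<in> challenges R \<Longrightarrow> y \<in> responses S \<Longrightarrow> related S (\<phi> x) y \<Longrightarrow> related R x (\<psi> y)"
    by (erule tukey_leE)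
  have E: "E \<subseteq> responses S" and dom: "\<And>x. x \<in> challenges S \<Longrightarrow> \<exists>y\<in>E. related S x y"
    using assms(2) by (auto simp: dominating_in_def)
  have "\<exists>y\<in>\<psi> ` E. related R x y" if "x \<in> challenges R" for x
    using dom[OF \<phi>[OF that]] rel[OF that] E by (meson imageI subsetD)
  moreover have "\<psi> ` E \<subseteq> responses R" using \<psi> E by (meson image_subsetI subsetD)
  ultimately have "dominating_in R (\<psi> ` E)" by (simp add: dominating_in_def)
  then show ?thesis using card_of_image by meson
qed

text \<open>
  The minimum that defines \<open>bnum\<close> is only meaningful when some unbounded set exists, hence the
  existence hypotheses here and in the analogous results below.
\<close>

lemma tukey_le_bnum:
  assumes "tukey_le R S" "unbounded_in R F"
  shows "bnum S \<le>o bnum R"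
proof -
  obtain F' where "unbounded_in R F'" and R: "bnum R = |F'|"
    using bnum_least(1)[OF assms(2)] by blast
  then obtain G where "unbounded_in S G" "|G| \<le>o |F'|"
    using tukey_le_unbounded[OF assms(1)] by blast
  then show ?thesis
    unfolding R using bnum_least(2) ordLeq_transitive by blast
qed

lemma tukey_le_dnum:
  assumes "tukey_le R S" "dominating_in S E"
  shows "dnum R \<le>o dnum S"
proof -
  obtain E' where "dominating_in S E'" and S: "dnum S = |E'|"
    using dnum_least(1)[OF assms(2)] by blast
  then obtain D where "dominating_in R D" "|D| \<le>o |E'|"
    using tukey_le_dominating[OF assms(1)] by blast
  then show ?thesis
    unfolding S using dnum_least(2) ordLeq_transitive by blast
qed

lemma tukey_equivalent_cardinals:
  assumes RS: "tukey_le R S" and SR: "tukey_le S R"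
    and F: "unbounded_in S F" and E: "dominating_in S E"
  shows "bnum R =o bnum S" and "dnum R =o dnum S"
proof -
  obtain F' E' where F': "unbounded_in R F'" and E': "dominating_in R E'"
    using tukey_le_unbounded[OF SR F] tukey_le_dominating[OF RS E] by blast
  show "bnum R =o bnum S"
    using tukey_le_bnum[OF RS F'] tukey_le_bnum[OF SR F] by (simp add: ordIso_iff_ordLeq)
  show "dnum R =o dnum S"
    using tukey_le_dnum[OF RS E] tukey_le_dnum[OF SR E'] by (simp add: ordIso_iff_ordLeq)
qed

definition dual :: "('x, 'y) rel_system \<Rightarrow> ('y, 'x) rel_system" where
  "dual R = \<lparr>challenges = responses R, responses = challenges R,
    related = (\<lambda>y x. \<not> related R x y)\<rparr>"

lemma unbounded_in_dual [simp]: "unbounded_in (dual R) = dominating_in R"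
  by (auto simp: fun_eq_iff unbounded_in_def bounded_in_def dominating_in_def dual_def)

lemma dominating_in_dual [simp]: "dominating_in (dual R) = unbounded_in R"
  by (auto simp: fun_eq_iff unbounded_in_def bounded_in_def dominating_in_def dual_def)

lemma bnum_dual: "bnum (dual R) = dnum R"
  by (simp add: bnum_def dnum_def)

lemma dnum_dual: "dnum (dual R) = bnum R"
  by (simp add: bnum_def dnum_def)

section \<open>Sparse orbits and enumerations\<close>

definition orbit :: "(nat \<Rightarrow> nat) \<Rightarrow> nat \<Rightarrow> nat" where
  "orbit g n = ((\<lambda>m. Suc (g m)) ^^ n) 0"

lemma orbit_Suc [simp]: "orbit g (Suc n) = Suc (g (orbit g n))"
  by (simp add: orbit_def)

lemma strict_mono_orbit:
  assumes "strict_mono g"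
  shows "strict_mono (orbit g)"
  unfolding strict_mono_Suc_iff
  using strict_mono_imp_increasing[OF assms] by (simp add: less_Suc_eq_le)

lemma infinite_range_orbit: "strict_mono g \<Longrightarrow> infinite (range (orbit g))"
  using strict_mono_orbit strict_mono_imp_inj_on range_inj_infinite by blast

lemma orbit_gap:
  assumes g: "strict_mono g" and "x \<in> range (orbit g)" "x' \<in> range (orbit g)" "x < x'"
  shows "g x < x'"
proof -
  obtain i j where ij: "x = orbit g i" "x' = orbit g j" using assms by blast
  then have "Suc i \<le> j"
    using \<open>x < x'\<close> strict_mono_less[OF strict_mono_orbit[OF g]] by (simp add: Suc_le_eq)
  then have "orbit g (Suc i) \<le> orbit g j"
    using strict_mono_less_eq[OF strict_mono_orbit[OF g]] by blast
  then show ?thesis using ij by simp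
qed

text \<open>
  The use of sparseness: an interval that catches two points of the orbit is long compared
  to \<open>g\<close>. The first bound is for recovering domination of \<open>g\<close> at every index, the second for
  contradicting domination by \<open>g\<close> at a late point of the orbit.
\<close>

lemma two_orbit_points_in_interval:
  assumes g: "strict_mono g" and f: "strict_mono f"
    and card: "1 < card ({f n..<f (Suc n)} \<inter> range (orbit g))"
  shows "g n < f (Suc n)" and "\<exists>x\<ge>n. g x < f (Suc x)"
proof -
  let ?A = "{f n..<f (Suc n)} \<inter> range (orbit g)"
  have "\<not> card ?A \<le> Suc 0" using card by simp
  then obtain u v where "u \<in> ?A" "v \<in> ?A" "u \<noteq> v"
    using card_le_Suc0_iff_eq[of ?A] by blast
  then have "\<exists>x x'. x \<in> ?A \<and> x' \<in> ?A \<and> x < x'"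
    by (meson linorder_neqE_nat)
  then obtain x x' where x: "x \<in> range (orbit g)" "x' \<in> range (orbit g)" "x < x'"
    "f n \<le> x" "x' < f (Suc n)"
    by auto
  have "n \<le> x" using strict_mono_imp_increasing[OF f, of n] x by linarith
  moreover have "g x < f (Suc n)" using orbit_gap[OF g x(1-3)] x(5) by linarith
  ultimately show "g n < f (Suc n)" "\<exists>x\<ge>n. g x < f (Suc x)"
    using strict_mono_less_eq[OF g, of n x] strict_mono_less_eq[OF f, of "Suc n" "Suc x"]
    by (auto intro!: exI[of _ x])
qed

text \<open>
  The elements of \<open>X\<close> with indices \<open>m, \<dots>, m + c\<close> are all \<open>\<ge> m\<close>, because the element with
  index \<open>i\<close> is \<open>\<ge> i\<close>. This avoids counting the elements of \<open>X\<close> below \<open>m\<close>, and makes the coding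
  function \<open>m \<mapsto> enumerate X (m + c)\<close> strictly increasing.
\<close>

lemma card_interval_enumerate:
  assumes X: "infinite X" and "a \<le> m" and "enumerate X (m + c) < b"
  shows "c < card ({a..<b} \<inter> X)"
proof -
  have "enumerate X ` {m..m + c} \<subseteq> {a..<b} \<inter> X"
  proof safe
    fix i assume i: "i \<in> {m..m + c}"
    show "enumerate X i \<in> X" using X by (rule enumerate_in_set)
    have "enumerate X i \<le> enumerate X (m + c)"
      using X i by (simp add: enumerate_mono_le_iff)
    then have "enumerate X i < b" using assms(3) by (rule le_less_trans)
    then show "enumerate X i \<in> {a..<b}"
      using le_enumerate[OF X, of i] i \<open>a \<le> m\<close> by simp
  qed
  then have "card (enumerate X ` {m..m + c}) \<le> card ({a..<b} \<inter> X)"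
    by (intro card_mono) auto
  moreover have "card (enumerate X ` {m..m + c}) = Suc c"
    using X by (subst card_image) (auto intro: inj_on_subset[OF inj_enumerate])
  ultimately show ?thesis by simp
qed

lemma strict_mono_enumerate_shift: "infinite X \<Longrightarrow> strict_mono (\<lambda>m. enumerate X (m + c))"
  by (simp add: strict_mono_def)

lemma strict_mono_interval:
  fixes f :: "nat \<Rightarrow> nat"
  assumes f: "strict_mono f" and "f N \<le> m"
  shows "\<exists>n\<ge>N. f n \<le> m \<and> m < f (Suc n)"
proof -
  have "f 0 \<le> m" using assms strict_mono_less_eq[OF f, of 0 N] by simp
  have ub: "\<forall>n. f n \<le> m \<longrightarrow> n \<le> m"
    using strict_mono_imp_increasing[OF f] le_trans by blast
  let ?n = "GREATEST n. f n \<le> m"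
  have n: "f ?n \<le> m" using GreatestI_nat[of "\<lambda>n. f n \<le> m", OF \<open>f N \<le> m\<close>] ub by blast
  moreover have "N \<le> ?n" using Greatest_le_nat[of "\<lambda>n. f n \<le> m", OF \<open>f N \<le> m\<close>] ub by blast
  moreover have "m < f (Suc ?n)"
    using Greatest_le_nat[of "\<lambda>n. f n \<le> m" "Suc ?n"] ub by (meson Suc_n_not_le_n not_le)
  ultimately show ?thesis by blast
qed

section \<open>Connections with the dominating order\<close>

lemma R_all_tukey_le_D:
  assumes "k \<ge> 1"
  shows "tukey_le (R_all k) D_sys"
proof (rule tukey_leI[where \<phi> = "\<lambda>f n. f (Suc n)" and \<psi> = "\<lambda>g. range (orbit g)"])
  fix f g assume "f \<in> challenges (R_all k)" "g \<in> responses D_sys"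
    and rel: "related D_sys (\<lambda>n. f (Suc n)) g"
  then have f: "strict_mono f" and g: "strict_mono g"
    by (auto simp: R_all_def D_sys_def increasing_funs_def)
  from rel obtain N where N: "\<forall>n\<ge>N. f (Suc n) \<le> g n"
    by (auto simp: D_sys_def MOST_nat_le)
  have "card ({f n..<f (Suc n)} \<inter> range (orbit g)) \<le> k" if "n \<ge> N" for n
  proof (rule ccontr)
    assume "\<not> ?thesis"
    with \<open>k \<ge> 1\<close> have "1 < card ({f n..<f (Suc n)} \<inter> range (orbit g))" by simp
    from two_orbit_points_in_interval(2)[OF g f this]
    show False using N \<open>n \<ge> N\<close> by (meson le_trans not_le)
  qed
  then show "related (R_all k) f (range (orbit g))"
    by (auto simp: R_all_def MOST_nat_le)
qed (auto simp: R_all_def D_sys_def increasing_funs_def infinite_sets_def strict_mono_def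
      infinite_range_orbit[unfolded strict_mono_def])

text \<open>
  A point \<open>m\<close> lies somewhere inside an interval, so \<open>g m\<close> is only bounded by the right end of the
  following one. Two consecutive intervals hold at most \<open>2 * k\<close> elements of \<open>X\<close>, which explains the
  shift by \<open>2 * k\<close>.
\<close>

lemma D_tukey_le_R_all: "tukey_le D_sys (R_all k)"
proof (rule tukey_leI[where \<phi> = orbit and \<psi> = "\<lambda>X m. enumerate X (m + 2 * k)"])
  fix g X assume "g \<in> challenges D_sys" "X \<in> responses (R_all k)"
    and rel: "related (R_all k) (orbit g) X"
  then have g: "strict_mono g" and X: "infinite X"
    by (auto simp: R_all_def D_sys_def increasing_funs_def infinite_sets_def)
  let ?f = "orbit g"
  note f = strict_mono_orbit[OF g]
  from rel obtain N where N: "\<forall>n\<ge>N. card ({?f n..<?f (Suc n)} \<inter> X) \<le> k"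
    by (auto simp: R_all_def MOST_nat_le)
  have "g m \<le> enumerate X (m + 2 * k)" if m: "?f N \<le> m" for m
  proof -
    obtain n where n: "n \<ge> N" "?f n \<le> m" "m < ?f (Suc n)"
      using strict_mono_interval[OF f m] by blast
    let ?b = "?f (Suc (Suc n))"
    have "{?f n..<?b} \<inter> X \<subseteq>
        ({?f n..<?f (Suc n)} \<inter> X) \<union> ({?f (Suc n)..<?b} \<inter> X)"
      by (auto simp del: orbit_Suc)
    then have "card ({?f n..<?b} \<inter> X)
        \<le> card (({?f n..<?f (Suc n)} \<inter> X) \<union> ({?f (Suc n)..<?b} \<inter> X))"
      by (intro card_mono) auto
    also have "\<dots> \<le> card ({?f n..<?f (Suc n)} \<inter> X) + card ({?f (Suc n)..<?b} \<inter> X)"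
      by (rule card_Un_le)
    also have "\<dots> \<le> k + k" using N n(1) by (intro add_mono) (auto simp del: orbit_Suc)
    finally have "?b \<le> enumerate X (m + 2 * k)"
      using card_interval_enumerate[OF X n(2), of "2 * k" ?b] by (metis mult_2 not_le)
    moreover have "g m < ?b"
      using strict_monoD[OF g n(3)] by simp
    ultimately show ?thesis by linarith
  qed
  then show "related D_sys g (\<lambda>m. enumerate X (m + 2 * k))"
    by (auto simp: D_sys_def MOST_nat_le)
qed (auto simp: R_all_def D_sys_def increasing_funs_def infinite_sets_def strict_mono_orbit
      strict_mono_enumerate_shift)

text \<open>
  The maps of the connection from \<open>R_all k\<close> to \<open>D_sys\<close> serve again, now by way of the first bound
  in \<open>two_orbit_points_in_interval\<close>: each of the infinitely many \<open>n\<close> at which \<open>g\<close> exceeds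
  \<open>n \<mapsto> f (n + 1)\<close> gives an interval \<open>[f n, f (n + 1))\<close> with at most one point of the orbit.
\<close>

lemma R_ex_tukey_le_dual_D:
  assumes "k \<ge> 1"
  shows "tukey_le (R_ex k) (dual D_sys)"
proof (rule tukey_leI[where \<phi> = "\<lambda>f n. f (Suc n)" and \<psi> = "\<lambda>g. range (orbit g)"])
  fix f g assume "f \<in> challenges (R_ex k)" "g \<in> responses (dual D_sys)"
    and rel: "related (dual D_sys) (\<lambda>n. f (Suc n)) g"
  then have f: "strict_mono f" and g: "strict_mono g"
    by (auto simp: R_ex_def D_sys_def dual_def increasing_funs_def)
  from rel have "\<exists>\<^sub>\<infinity>n. \<not> g n \<le> f (Suc n)"
    by (simp add: D_sys_def dual_def not_MOST)
  then have "\<exists>\<^sub>\<infinity>n. card ({f n..<f (Suc n)} \<inter> range (orbit g)) \<le> k"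
  proof (rule INFM_mono)
    fix n assume "\<not> g n \<le> f (Suc n)"
    then have "\<not> 1 < card ({f n..<f (Suc n)} \<inter> range (orbit g))"
      using two_orbit_points_in_interval(1)[OF g f] by force
    then show "card ({f n..<f (Suc n)} \<inter> range (orbit g)) \<le> k" using \<open>k \<ge> 1\<close> by linarith
  qed
  then show "related (R_ex k) f (range (orbit g))" by (simp add: R_ex_def)
qed (auto simp: R_ex_def D_sys_def dual_def increasing_funs_def infinite_sets_def strict_mono_def
      infinite_range_orbit[unfolded strict_mono_def])

text \<open>
  Here the argument only looks at the left ends of the intervals, where \<open>g\<close> is bounded by the right
  end of the same interval, so the shift by \<open>k\<close> is enough.
\<close>

lemma dual_D_tukey_le_R_ex: "tukey_le (dual D_sys) (R_ex k)"
proof (rule tukey_leI[where \<phi> = orbit and \<psi> = "\<lambda>X m. enumerate X (m + k)"])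
  fix g X assume "g \<in> challenges (dual D_sys)" "X \<in> responses (R_ex k)"
    and rel: "related (R_ex k) (orbit g) X"
  then have g: "strict_mono g" and X: "infinite X"
    by (auto simp: R_ex_def D_sys_def dual_def increasing_funs_def infinite_sets_def)
  let ?f = "orbit g"
  have "\<not> (\<forall>\<^sub>\<infinity>m. enumerate X (m + k) \<le> g m)"
  proof
    assume "\<forall>\<^sub>\<infinity>m. enumerate X (m + k) \<le> g m"
    then obtain N where N: "\<forall>m\<ge>N. enumerate X (m + k) \<le> g m" by (auto simp: MOST_nat_le)
    have "k < card ({?f n..<?f (Suc n)} \<inter> X)" if "n \<ge> N" for n
    proof -
      have "N \<le> ?f n"
        using strict_mono_imp_increasing[OF strict_mono_orbit[OF g], of n] that by linarith
      then have "enumerate X (?f n + k) < ?f (Suc n)" using N by (simp add: less_Suc_eq_le)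
      then show ?thesis by (intro card_interval_enumerate[OF X order_refl])
    qed
    then have "\<forall>\<^sub>\<infinity>n. \<not> card ({?f n..<?f (Suc n)} \<inter> X) \<le> k"
      unfolding MOST_nat_le not_le by blast
    moreover have "\<exists>\<^sub>\<infinity>n. card ({?f n..<?f (Suc n)} \<inter> X) \<le> k" using rel by (simp add: R_ex_def)
    ultimately show False by (simp add: not_INFM[symmetric] del: orbit_Suc not_INFM)
  qed
  then show "related (dual D_sys) g (\<lambda>m. enumerate X (m + k))"
    by (simp add: D_sys_def dual_def)
qed (auto simp: R_ex_def D_sys_def dual_def increasing_funs_def infinite_sets_def strict_mono_orbit
      strict_mono_enumerate_shift)

section \<open>The four cardinals\<close>

lemma unbounded_in_D: "unbounded_in D_sys increasing_funs"
proof -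
  have "\<exists>x\<in>increasing_funs. \<not> (\<forall>\<^sub>\<infinity>n. x n \<le> y n)" if "y \<in> increasing_funs" for y :: "nat \<Rightarrow> nat"
    using that by (intro bexI[of _ "\<lambda>n. Suc (y n)"])
      (auto simp: increasing_funs_def strict_mono_def)
  then show ?thesis by (auto simp: unbounded_in_def bounded_in_def D_sys_def)
qed

lemma dominating_in_D: "dominating_in D_sys increasing_funs"
  by (auto simp: dominating_in_def D_sys_def intro!: bexI)

theorem theoremA:
  fixes k :: nat
  assumes "k \<ge> 1"
  shows "bnum (R_all k) =o bnum D_sys \<and> dnum (R_all k) =o dnum D_sys
       \<and> bnum (R_ex k) =o dnum D_sys \<and> dnum (R_ex k) =o bnum D_sys"
proof -
  note all = tukey_equivalent_cardinals[OF R_all_tukey_le_D[OF assms] D_tukey_le_R_all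
      unbounded_in_D dominating_in_D]
  have "bnum (R_ex k) =o bnum (dual D_sys)" "dnum (R_ex k) =o dnum (dual D_sys)"
    using tukey_equivalent_cardinals[OF R_ex_tukey_le_dual_D[OF assms] dual_D_tukey_le_R_ex]
      unbounded_in_D dominating_in_D by auto
  with all show ?thesis by (simp add: bnum_dual dnum_dual)
qed

end
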